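(* Let $(X,d)$ be a proper, roughly geodesic, strongly hyperbolic metric space with base point $o\in X$, and let $\Gamma$ be a non-elementary discrete group of isometries of $(X,d)$ acting cocompactly on $X$. Put $|\gamma|=d(o,\gamma o)$. For every $s\in[0,\frac12)\cup(\frac12,1]$ the boundary representation $\pi_s$ of $\Gamma$ on $L^2(\partial X,\nu_o)$ is of $\alpha|\frac12-s|$-exponential type, i.e. there is a constant $C>0$ such that for all $\gamma\in\Gamma$, $$\|\pi_s(\gamma)\|_{op}\le C e^{\alpha|\frac12-s|\,|\gamma|}.$$
   Context: Gromov product: $(x,y)_o=\frac12(d(x,o)+d(y,o)-d(x,y))$. $(X,d)$ is strongly hyperbolic if for some $\epsilon>0$, $e^{-\epsilon(x,y)_o}\le e^{-\epsilon(x,z)_o}+e^{-\epsilon(z,y)_o}$ for all $x,y,z,o\in X$. It is then Gromov hyperbolic, the Gromov product extends continuously to $X\cup\partial X$ ($\partial X$ the Gromov boundary), and $d_o(\xi,\eta)=e^{-\epsilon(\xi,\eta)_o}$ is a metric on $\partial X$. Roughly geodesic: there is $C_X>0$ such that any $x,y\in X$ are joined by a map $r:[a,b]\to X$, $r(a)=x$, $r(b)=y$, with $|t-u|-C_X\le d(r(t),r(u))\le|t-u|+C_X$. A discrete group of isometries is one acting properly discontinuously. Volume growth: $\alpha=\limsup_{T\to\infty}\frac1T\log|\Gamma o\cap B_X(o,T)|$. Busemann function: $\beta_\xi(x,y)=2(\xi,y)_x-d(x,y)$ for $\xi\in\partial X$, $x,y\in X$. The Patterson–Sullivan measure $\nu_o$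 is the Hausdorff measure of dimension $\alpha/\epsilon$ on $(\partial X,d_o)$ normalized to be a probability measure; it satisfies $\frac{d\gamma_*\nu_o}{d\nu_o}(\xi)=e^{\alpha\beta_\xi(o,\gamma o)}$. Boundary representations, for $s\in\mathbb{R}$: $\pi_s(\gamma)v(\xi)=\big(\frac{d\gamma_*\nu_o}{d\nu_o}(\xi)\big)^s v(\gamma^{-1}\xi)$ for $v\in L^2(\partial X,\nu_o)$. *)

theory Defs
  imports "HOL-Analysis.Analysis" "HOL-Algebra.Bij"
begin

section \<open>Strongly hyperbolic spaces and their Gromov boundary\<close>

text \<open>The space \<open>X\<close> is the whole type \<open>'a\<close>.\<close>

definition gromov_product :: "'a::metric_space \<Rightarrow> 'a \<Rightarrow> 'a \<Rightarrow> real" where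
  "gromov_product x0 x y = (dist x x0 + dist y x0 - dist x y) / 2"

definition strongly_hyperbolic :: "real \<Rightarrow> 'a::metric_space itself \<Rightarrow> bool" where
  "strongly_hyperbolic \<epsilon> TYPE('a) \<longleftrightarrow> \<epsilon> > 0 \<and>
     (\<forall>x y z w::'a. exp (- \<epsilon> * gromov_product w x y)
        \<le> exp (- \<epsilon> * gromov_product w x z) + exp (- \<epsilon> * gromov_product w z y))"

definition proper_space :: "'a::metric_space itself \<Rightarrow> bool" where
  "proper_space TYPE('a) \<longleftrightarrow> (\<forall>(x::'a) r. compact (cball x r))"

definition roughly_geodesic :: "'a::metric_space itself \<Rightarrow> bool" where
  "roughly_geodesic TYPE('a) \<longleftrightarrow>
     (\<exists>C>0. \<forall>x y::'a. \<exists>a b. \<exists>r::real \<Rightarrow> 'a. a \<le> b \<and> r a = x \<and> r b = y \<and>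
        (\<forall>t\<in>{a..b}. \<forall>u\<in>{a..b}. \<bar>t - u\<bar> - C \<le> dist (r t) (r u) \<and> dist (r t) (r u) \<le> \<bar>t - u\<bar> + C))"

definition sequences_to_infinity :: "'a::metric_space \<Rightarrow> (nat \<Rightarrow> 'a) set" where
  "sequences_to_infinity x0 =
     {u. filterlim (\<lambda>(i, j). gromov_product x0 (u i) (u j)) at_top (sequentially \<times>\<^sub>F sequentially)}"

definition asymptotic :: "'a::metric_space \<Rightarrow> ((nat \<Rightarrow> 'a) \<times> (nat \<Rightarrow> 'a)) set" where
  "asymptotic x0 =
     {(u, v). u \<in> sequences_to_infinity x0 \<and> v \<in> sequences_to_infinity x0 \<and>
        filterlim (\<lambda>(i, j). gromov_product x0 (u i) (v j)) at_top (sequentially \<times>\<^sub>F sequentially)}"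

definition gromov_boundary :: "'a::metric_space \<Rightarrow> (nat \<Rightarrow> 'a) set set" where
  "gromov_boundary x0 = sequences_to_infinity x0 // asymptotic x0"

text \<open>The continuous extension of the Gromov product to pairs of boundary points; a boundary point
  is the set of all sequences converging to it. The value is \<open>\<infinity>\<close> on the diagonal.\<close>

definition boundary_product ::
    "'a::metric_space \<Rightarrow> (nat \<Rightarrow> 'a) set \<Rightarrow> (nat \<Rightarrow> 'a) set \<Rightarrow> ereal" where
  "boundary_product x0 \<xi> \<eta> =
     (THE l. \<forall>u\<in>\<xi>. \<forall>v\<in>\<eta>. (\<lambda>n. ereal (gromov_product x0 (u n) (v n))) \<longlonglongrightarrow> l)"

definition boundary_dist ::
    "real \<Rightarrow> 'a::metric_space \<Rightarrow> (nat \<Rightarrow> 'a) set \<Rightarrow> (nat \<Rightarrow> 'a) set \<Rightarrow> real" where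
  "boundary_dist \<epsilon> x0 \<xi> \<eta> =
     (if boundary_product x0 \<xi> \<eta> = \<infinity> then 0
      else exp (- \<epsilon> * real_of_ereal (boundary_product x0 \<xi> \<eta>)))"


section \<open>Groups of isometries\<close>

definition isometry_group :: "('a::metric_space \<Rightarrow> 'a) set \<Rightarrow> bool" where
  "isometry_group \<Gamma> \<longleftrightarrow>
     subgroup \<Gamma> (BijGroup UNIV) \<and> (\<forall>\<gamma>\<in>\<Gamma>. \<forall>x y. dist (\<gamma> x) (\<gamma> y) = dist x y)"

definition properly_discontinuous :: "('a::metric_space \<Rightarrow> 'a) set \<Rightarrow> bool" where
  "properly_discontinuous \<Gamma> \<longleftrightarrow> (\<forall>K. compact K \<longrightarrow> finite {\<gamma>\<in>\<Gamma>. \<gamma> ` K \<inter> K \<noteq> {}})"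

definition cocompact :: "('a::metric_space \<Rightarrow> 'a) set \<Rightarrow> bool" where
  "cocompact \<Gamma> \<longleftrightarrow> (\<exists>K. compact K \<and> (\<Union>\<gamma>\<in>\<Gamma>. \<gamma> ` K) = UNIV)"

definition limit_set :: "('a::metric_space \<Rightarrow> 'a) set \<Rightarrow> 'a \<Rightarrow> (nat \<Rightarrow> 'a) set set" where
  "limit_set \<Gamma> x0 = {\<xi> \<in> gromov_boundary x0. \<exists>g. range g \<subseteq> \<Gamma> \<and> (\<lambda>n. g n x0) \<in> \<xi>}"

text \<open>Non-elementary: the limit set has more than two points.\<close>

definition non_elementary :: "('a::metric_space \<Rightarrow> 'a) set \<Rightarrow> 'a \<Rightarrow> bool" where
  "non_elementary \<Gamma> x0 \<longleftrightarrow> \<not> (finite (limit_set \<Gamma> x0) \<and> card (limit_set \<Gamma> x0) \<le> 2)"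

definition boundary_action :: "('a \<Rightarrow> 'a) \<Rightarrow> (nat \<Rightarrow> 'a) set \<Rightarrow> (nat \<Rightarrow> 'a) set" where
  "boundary_action \<gamma> \<xi> = (\<lambda>u. \<gamma> \<circ> u) ` \<xi>"

text \<open>The limit superior is taken in the extended reals. The proper discontinuity and cocompactness
  of the action make the balls finite and the limit superior a real number.\<close>

definition volume_growth :: "('a::metric_space \<Rightarrow> 'a) set \<Rightarrow> 'a \<Rightarrow> real" where
  "volume_growth \<Gamma> x0 = real_of_ereal
     (Limsup at_top (\<lambda>T::real. ereal (ln (real (card ((\<lambda>\<gamma>. \<gamma> x0) ` \<Gamma> \<inter> ball x0 T))) / T)))"


section \<open>Hausdorff measure and the Patterson--Sullivan measure\<close>

definition set_diameter :: "('b \<Rightarrow> 'b \<Rightarrow> real) \<Rightarrow> 'b set \<Rightarrow> real" where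
  "set_diameter d U = (if U = {} then 0 else SUP (x, y)\<in>U \<times> U. d x y)"

text \<open>Intended for dimensions \<open>t > 0\<close> only: as \<open>0 powr 0 = 0\<close>, the case \<open>t = 0\<close> is not the counting
  measure. The bound by \<open>\<delta>\<close> makes the covering sets bounded, so that their diameters are genuine suprema.\<close>

definition hausdorff_premeasure ::
    "'b set \<Rightarrow> ('b \<Rightarrow> 'b \<Rightarrow> real) \<Rightarrow> real \<Rightarrow> real \<Rightarrow> 'b set \<Rightarrow> ennreal" where
  "hausdorff_premeasure M d t \<delta> A =
     (INF U \<in> {U :: nat \<Rightarrow> 'b set.
                 (\<forall>i. U i \<subseteq> M \<and> (\<forall>x\<in>U i. \<forall>y\<in>U i. d x y \<le> \<delta>)) \<and> A \<subseteq> (\<Union>i. U i)}.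
        (\<Sum>i. ennreal (set_diameter d (U i) powr t)))"

definition hausdorff_outer_measure ::
    "'b set \<Rightarrow> ('b \<Rightarrow> 'b \<Rightarrow> real) \<Rightarrow> real \<Rightarrow> 'b set \<Rightarrow> ennreal" where
  "hausdorff_outer_measure M d t A = (SUP \<delta>\<in>{0<..}. hausdorff_premeasure M d t \<delta> A)"

definition hausdorff_measure ::
    "'b set \<Rightarrow> ('b \<Rightarrow> 'b \<Rightarrow> real) \<Rightarrow> real \<Rightarrow> 'b measure" where
  "hausdorff_measure M d t =
     measure_of M {U. openin (Metric_space.mtopology M d) U} (hausdorff_outer_measure M d t)"

definition patterson_sullivan ::
    "real \<Rightarrow> ('a::metric_space \<Rightarrow> 'a) set \<Rightarrow> 'a \<Rightarrow> (nat \<Rightarrow> 'a) set measure" where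
  "patterson_sullivan \<epsilon> \<Gamma> x0 =
     (let H = hausdorff_measure (gromov_boundary x0) (boundary_dist \<epsilon> x0) (volume_growth \<Gamma> x0 / \<epsilon>)
      in scale_measure (1 / emeasure H (space H)) H)"


section \<open>Boundary representations\<close>

text \<open>\<open>L\<^sup>2\<close> is represented by functions rather than by their almost-everywhere classes. The norm is
  \<open>\<infinity>\<close> for functions outside \<open>L\<^sup>2\<close>, so that a linear operator of finite operator norm maps \<open>L\<^sup>2\<close> to itself
  and null functions to null functions.\<close>

definition L2_norm :: "'b measure \<Rightarrow> ('b \<Rightarrow> complex) \<Rightarrow> ennreal" where
  "L2_norm M v =
     (if v \<in> borel_measurable M \<and> integrable M (\<lambda>x. (cmod (v x))\<^sup>2)
      then ennreal (sqrt (LINT x|M. (cmod (v x))\<^sup>2)) else \<infinity>)"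

definition L2_operator_norm ::
    "'b measure \<Rightarrow> (('b \<Rightarrow> complex) \<Rightarrow> ('b \<Rightarrow> complex)) \<Rightarrow> ennreal" where
  "L2_operator_norm M T = (SUP v \<in> {v. L2_norm M v \<le> 1}. L2_norm M (T v))"

definition boundary_representation ::
    "(nat \<Rightarrow> 'a) set measure \<Rightarrow> real \<Rightarrow> ('a \<Rightarrow> 'a) \<Rightarrow>
     ((nat \<Rightarrow> 'a) set \<Rightarrow> complex) \<Rightarrow> ((nat \<Rightarrow> 'a) set \<Rightarrow> complex)" where
  "boundary_representation \<nu> s \<gamma> v \<xi> =
     of_real (enn2real (RN_deriv \<nu> (distr \<nu> \<nu> (boundary_action \<gamma>)) \<xi>) powr s)
       * v (boundary_action (inv_into UNIV \<gamma>) \<xi>)"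

end

theory Submission
  imports Defs
begin

text \<open>An isometry \<open>\<gamma>\<close> moves the base point by \<open>|\<gamma>|\<close>, so it changes Gromov products by at most
  \<open>|\<gamma>|\<close> and acts on \<open>(\<partial>X, d\<^sub>o)\<close> with Lipschitz constant \<open>exp (\<epsilon> |\<gamma>|)\<close>, and so does its inverse. In
  dimension \<open>\<alpha> / \<epsilon>\<close> the Hausdorff measure is therefore distorted by a factor of at most \<open>exp (\<alpha> |\<gamma>|)\<close>,
  and the Radon--Nikodym derivative \<open>D\<close> lies between \<open>exp (- \<alpha> |\<gamma>|)\<close> and \<open>exp (\<alpha> |\<gamma>|)\<close>. Writing
  \<open>D\<^sup>2\<^sup>s = D\<^sup>2\<^sup>s\<^sup>-\<^sup>1 D\<close> and integrating against \<open>D \<nu> = \<gamma>\<^sub>* \<nu>\<close> gives the bound with constant 1.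
  If the Hausdorff measure of the boundary is 0 or infinite, its normalization is the zero
  measure, so that case needs no separate treatment.\<close>

section \<open>The metric on the boundary\<close>

text \<open>The formula of the boundary metric \<open>d\<^sub>o\<close> evaluated at points of the
  space itself. It is positive on the diagonal, hence no metric there, but it satisfies the triangle
  inequality, and Gromov products tending to infinity become values tending to 0.\<close>

definition visual_kernel :: "real \<Rightarrow> 'a::metric_space \<Rightarrow> 'a \<Rightarrow> 'a \<Rightarrow> real" where
  "visual_kernel \<epsilon> x0 x y = exp (- \<epsilon> * gromov_product x0 x y)"

lemma gromov_product_commute: "gromov_product x0 x y = gromov_product x0 y x"
  by (simp add: gromov_product_def dist_commute)

lemma visual_kernel_commute: "visual_kernel \<epsilon> x0 x y = visual_kernel \<epsilon> x0 y x"
  by (simp add: visual_kernel_def gromov_product_commute)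

lemma visual_kernel_pos: "0 < visual_kernel \<epsilon> x0 x y"
  by (simp add: visual_kernel_def)

lemma boundary_dist_nonneg: "0 \<le> boundary_dist \<epsilon> x0 \<xi> \<eta>"
  by (simp add: boundary_dist_def)

lemma boundary_dist_commute: "boundary_dist \<epsilon> x0 \<xi> \<eta> = boundary_dist \<epsilon> x0 \<eta> \<xi>"
proof -
  have "boundary_product x0 \<xi> \<eta> = boundary_product x0 \<eta> \<xi>"
    unfolding boundary_product_def
    \<comment> \<open>The two definite descriptions have the same defining predicate, so symmetry
      holds whether or not the limit exists.\<close>
    by (rule arg_cong[where f = The], subst gromov_product_commute) blast
  then show ?thesis
    by (simp add: boundary_dist_def)
qed

section \<open>Sequences to infinity as Cauchy sequences for the kernel\<close>

locale strongly_hyperbolic_space =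
  fixes \<epsilon> :: real and x0 :: "'a::metric_space"
  assumes hyp: "strongly_hyperbolic \<epsilon> TYPE('a)"
begin

abbreviation \<rho> :: "'a \<Rightarrow> 'a \<Rightarrow> real" where "\<rho> \<equiv> visual_kernel \<epsilon> x0"

lemma \<epsilon>_pos: "0 < \<epsilon>"
  using hyp by (simp add: strongly_hyperbolic_def)

lemma visual_kernel_triangle: "\<rho> x y \<le> \<rho> x z + \<rho> z y"
  using hyp by (simp add: strongly_hyperbolic_def visual_kernel_def)

lemma visual_kernel_less_iff: "\<rho> x y < exp (- \<epsilon> * Z) \<longleftrightarrow> Z < gromov_product x0 x y"
  using \<epsilon>_pos by (simp add: visual_kernel_def)

text \<open>As \<open>Z\<close> runs over the reals, \<open>exp (- \<epsilon> * Z)\<close> runs over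
  all positive reals. Hence sequences to infinity behave like Cauchy sequences for
  \<open>\<rho>\<close>, and asymptotic ones like equivalent Cauchy sequences.\<close>

lemma filterlim_gromov_product_iff:
  "filterlim (\<lambda>(i, j). gromov_product x0 (u i) (v j)) at_top (sequentially \<times>\<^sub>F sequentially) \<longleftrightarrow>
   (\<forall>e>0. \<exists>N. \<forall>i\<ge>N. \<forall>j\<ge>N. \<rho> (u i) (v j) < e)" (is "?L \<longleftrightarrow> ?R")
proof -
  have "?L \<longleftrightarrow> (\<forall>Z. \<exists>N. \<forall>i\<ge>N. \<forall>j\<ge>N. \<rho> (u i) (v j) < exp (- \<epsilon> * Z))"
    unfolding filterlim_at_top_dense eventually_prod_sequentially visual_kernel_less_iff prod.case
    by meson
  also have "\<dots> \<longleftrightarrow> ?R"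
  proof (intro iffI allI impI)
    fix e :: real
    assume *: "\<forall>Z. \<exists>N. \<forall>i\<ge>N. \<forall>j\<ge>N. \<rho> (u i) (v j) < exp (- \<epsilon> * Z)" and "0 < e"
    then have "exp (- \<epsilon> * (- ln e / \<epsilon>)) = e"
      using \<epsilon>_pos by simp
    with * show "\<exists>N. \<forall>i\<ge>N. \<forall>j\<ge>N. \<rho> (u i) (v j) < e"
      by metis
  qed auto
  finally show ?thesis .
qed

lemma asymptotic_iff:
  "(u, v) \<in> asymptotic x0 \<longleftrightarrow> u \<in> sequences_to_infinity x0 \<and> v \<in> sequences_to_infinity x0 \<and>
    (\<forall>e>0. \<exists>N. \<forall>i\<ge>N. \<forall>j\<ge>N. \<rho> (u i) (v j) < e)"
  by (simp add: asymptotic_def filterlim_gromov_product_iff)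

lemma sequences_to_infinity_iff:
  "u \<in> sequences_to_infinity x0 \<longleftrightarrow> (\<forall>e>0. \<exists>N. \<forall>i\<ge>N. \<forall>j\<ge>N. \<rho> (u i) (u j) < e)"
  by (simp add: sequences_to_infinity_def filterlim_gromov_product_iff)

lemma equiv_asymptotic: "equiv (sequences_to_infinity x0) (asymptotic x0)"
proof (rule equivI)
  show "asymptotic x0 \<subseteq> sequences_to_infinity x0 \<times> sequences_to_infinity x0"
    by (auto simp: asymptotic_def)
  show "refl_on (sequences_to_infinity x0) (asymptotic x0)"
    by (auto simp: refl_on_def asymptotic_iff sequences_to_infinity_iff)
  show "sym (asymptotic x0)"
    unfolding sym_def asymptotic_iff by (subst visual_kernel_commute) blast
  show "trans (asymptotic x0)"
  proof (rule transI)
    fix u v w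
    assume uv: "(u, v) \<in> asymptotic x0" and vw: "(v, w) \<in> asymptotic x0"
    have "\<exists>N. \<forall>i\<ge>N. \<forall>j\<ge>N. \<rho> (u i) (w j) < e" if "0 < e" for e
    proof -
      have e2: "0 < e / 2" using that by simp
      obtain N1 where N1: "\<And>i j. i \<ge> N1 \<Longrightarrow> j \<ge> N1 \<Longrightarrow> \<rho> (u i) (v j) < e / 2"
        using uv e2 unfolding asymptotic_iff by blast
      obtain N2 where N2: "\<And>i j. i \<ge> N2 \<Longrightarrow> j \<ge> N2 \<Longrightarrow> \<rho> (v i) (w j) < e / 2"
        using vw e2 unfolding asymptotic_iff by blast
      \<comment> \<open>One entry of \<open>v\<close> beyond both thresholds serves as the
        intermediate point of the triangle inequality.\<close>
      have "\<rho> (u i) (w j) < e" if "i \<ge> max N1 N2" "j \<ge> max N1 N2" for i j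
        using visual_kernel_triangle[of "u i" "w j" "v (max N1 N2)"]
          N1[of i "max N1 N2"] N2[of "max N1 N2" j] that by simp
      then show ?thesis by blast
    qed
    with uv vw show "(u, w) \<in> asymptotic x0"
      by (auto simp: asymptotic_iff)
  qed
qed

section \<open>Limits of the kernel and the boundary metric\<close>

lemma asymptotic_tendsto:
  assumes "(u, v) \<in> asymptotic x0"
  shows "(\<lambda>n. \<rho> (u n) (v n)) \<longlonglongrightarrow> 0"
proof (rule LIMSEQ_I)
  fix e :: real assume "0 < e"
  then show "\<exists>N. \<forall>n\<ge>N. norm (\<rho> (u n) (v n) - 0) < e"
    using assms visual_kernel_pos[of \<epsilon> x0] unfolding asymptotic_iff
    by (metis abs_of_pos diff_zero real_norm_def)
qed

lemma gromov_boundary_asymptotic: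
  "\<lbrakk>\<xi> \<in> gromov_boundary x0; u \<in> \<xi>; v \<in> \<xi>\<rbrakk> \<Longrightarrow> (u, v) \<in> asymptotic x0"
  unfolding gromov_boundary_def using equiv_asymptotic in_quotient_imp_in_rel by fastforce

lemma gromov_boundary_subset:
  "\<xi> \<in> gromov_boundary x0 \<Longrightarrow> \<xi> \<subseteq> sequences_to_infinity x0"
  unfolding gromov_boundary_def using equiv_asymptotic in_quotient_imp_subset by blast

lemma gromov_boundary_nonempty: "\<xi> \<in> gromov_boundary x0 \<Longrightarrow> \<exists>u. u \<in> \<xi>"
  unfolding gromov_boundary_def using equiv_asymptotic in_quotient_imp_non_empty by blast

text \<open>Quadrilateral inequality, from the triangle inequality applied twice in each direction.
  It yields both the convergence of the kernel along two sequences to infinity and the independence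
  of its limit from the representatives.\<close>

lemma visual_kernel_diff: "\<bar>\<rho> x y - \<rho> x' y'\<bar> \<le> \<rho> x x' + \<rho> y y'"
  using visual_kernel_triangle[of x y x'] visual_kernel_triangle[of x' y y']
    visual_kernel_triangle[of x' y' x] visual_kernel_triangle[of x y' y]
    visual_kernel_commute[of \<epsilon> x0 x x'] visual_kernel_commute[of \<epsilon> x0 y y']
  by linarith

lemma visual_kernel_convergent:
  assumes "u \<in> sequences_to_infinity x0" "v \<in> sequences_to_infinity x0"
  shows "convergent (\<lambda>n. \<rho> (u n) (v n))"
proof -
  have "Cauchy (\<lambda>n. \<rho> (u n) (v n))"
  proof (rule CauchyI)
    fix e :: real assume "0 < e"
    then have e2: "0 < e / 2" by simp
    obtain N1 where N1: "\<And>i j. i \<ge> N1 \<Longrightarrow> j \<ge> N1 \<Longrightarrow> \<rho> (u i) (u j) < e / 2"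
      using assms(1) e2 unfolding sequences_to_infinity_iff by blast
    obtain N2 where N2: "\<And>i j. i \<ge> N2 \<Longrightarrow> j \<ge> N2 \<Longrightarrow> \<rho> (v i) (v j) < e / 2"
      using assms(2) e2 unfolding sequences_to_infinity_iff by blast
    have "norm (\<rho> (u m) (v m) - \<rho> (u n) (v n)) < e" if "m \<ge> max N1 N2" "n \<ge> max N1 N2" for m n
      using visual_kernel_diff[of "u m" "v m" "u n" "v n"] N1[of m n] N2[of m n] that by simp
    then show "\<exists>M. \<forall>m\<ge>M. \<forall>n\<ge>M. norm (\<rho> (u m) (v m) - \<rho> (u n) (v n)) < e"
      by blast
  qed
  then show ?thesis
    by (simp add: Cauchy_convergent_iff)
qed

lemma gromov_product_tendsto:
  assumes l: "(\<lambda>n. \<rho> (u n) (v n)) \<longlonglongrightarrow> l"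
  shows "(\<lambda>n. ereal (gromov_product x0 (u n) (v n))) \<longlonglongrightarrow>
    (if l = 0 then \<infinity> else ereal (- ln l / \<epsilon>))"
proof (cases "l = 0")
  case True
  have "\<forall>\<^sub>F n in sequentially. Z < gromov_product x0 (u n) (v n)" for Z
    using order_tendstoD(2)[OF l, of "exp (- \<epsilon> * Z)"] unfolding visual_kernel_less_iff True by simp
  then have "filterlim (\<lambda>n. gromov_product x0 (u n) (v n)) at_top sequentially"
    by (simp add: filterlim_at_top_dense)
  then show ?thesis
    using True by (simp add: tendsto_PInfty_eq_at_top)
next
  case False
  have "gromov_product x0 (u n) (v n) = - ln (\<rho> (u n) (v n)) / \<epsilon>" for n
    using \<epsilon>_pos by (simp add: visual_kernel_def)
  moreover have "(\<lambda>n. - ln (\<rho> (u n) (v n)) / \<epsilon>) \<longlonglongrightarrow> - ln l / \<epsilon>"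
    using False \<epsilon>_pos by (intro tendsto_intros l) auto
  ultimately show ?thesis
    using False by simp
qed

text \<open>The limit of the kernel exists and is the same for all representatives, so the definite
  description behind the boundary product denotes a value. Inequalities for the kernel can
  thereafter be passed to the limit to give inequalities for the boundary metric.\<close>

lemma boundary_dist_tendsto:
  assumes \<xi>: "\<xi> \<in> gromov_boundary x0" "u \<in> \<xi>" and \<eta>: "\<eta> \<in> gromov_boundary x0" "v \<in> \<eta>"
  shows "(\<lambda>n. \<rho> (u n) (v n)) \<longlonglongrightarrow> boundary_dist \<epsilon> x0 \<xi> \<eta>"
proof -
  obtain l where l: "(\<lambda>n. \<rho> (u n) (v n)) \<longlonglongrightarrow> l"
    using visual_kernel_convergent gromov_boundary_subset assms unfolding convergent_def
    by (meson subsetD)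
  \<comment> \<open>For \<open>l \<noteq> 0\<close> this makes \<open>l\<close> positive, so that
    the exponential undoes the logarithm at the end; \<open>l = 0\<close> corresponds to an infinite
    product.\<close>
  have "0 \<le> l"
    by (rule LIMSEQ_le_const[OF l]) (simp add: less_imp_le visual_kernel_pos)
  let ?L = "if l = 0 then \<infinity> else ereal (- ln l / \<epsilon>)"
  have "(\<lambda>n. \<rho> (u' n) (v' n)) \<longlonglongrightarrow> l" if u': "u' \<in> \<xi>" and v': "v' \<in> \<eta>" for u' v'
  proof -
    \<comment> \<open>Two representatives of one class are asymptotic, so both terms of the
      quadrilateral bound vanish in the limit.\<close>
    have "(\<lambda>n. \<rho> (u' n) (u n) + \<rho> (v' n) (v n)) \<longlonglongrightarrow> 0 + 0"
      by (intro tendsto_add asymptotic_tendsto gromov_boundary_asymptotic[OF \<xi>(1)]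
          gromov_boundary_asymptotic[OF \<eta>(1)] \<xi>(2) \<eta>(2) u' v')
    then have "(\<lambda>n. \<rho> (u' n) (v' n) - \<rho> (u n) (v n)) \<longlonglongrightarrow> 0"
      by (rule Lim_null_comparison[rotated, OF tendsto_eq_rhs]) (simp_all add: visual_kernel_diff)
    from tendsto_add[OF this l] show ?thesis
      by simp
  qed
  then have L: "\<forall>u\<in>\<xi>. \<forall>v\<in>\<eta>. (\<lambda>n. ereal (gromov_product x0 (u n) (v n))) \<longlonglongrightarrow> ?L"
    using gromov_product_tendsto by blast
  have "boundary_product x0 \<xi> \<eta> = ?L"
    unfolding boundary_product_def
  proof (rule the_equality)
    show "\<forall>u\<in>\<xi>. \<forall>v\<in>\<eta>. (\<lambda>n. ereal (gromov_product x0 (u n) (v n))) \<longlonglongrightarrow> ?L"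
      by (rule L)
    show "l' = ?L" if "\<forall>u\<in>\<xi>. \<forall>v\<in>\<eta>. (\<lambda>n. ereal (gromov_product x0 (u n) (v n))) \<longlonglongrightarrow> l'" for l'
      using LIMSEQ_unique that L \<xi>(2) \<eta>(2) by blast
  qed
  then have "boundary_dist \<epsilon> x0 \<xi> \<eta> = l"
    using \<epsilon>_pos \<open>0 \<le> l\<close> by (simp add: boundary_dist_def)
  with l show ?thesis
    by simp
qed

lemma boundary_dist_eq_0_iff:
  assumes \<xi>: "\<xi> \<in> gromov_boundary x0" and \<eta>: "\<eta> \<in> gromov_boundary x0"
  shows "boundary_dist \<epsilon> x0 \<xi> \<eta> = 0 \<longleftrightarrow> \<xi> = \<eta>"
proof -
  obtain u v where u: "u \<in> \<xi>" and v: "v \<in> \<eta>"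
    using gromov_boundary_nonempty \<xi> \<eta> by blast
  note lim = boundary_dist_tendsto[OF \<xi> u \<eta> v]
  show ?thesis
  proof
    assume "\<xi> = \<eta>"
    then show "boundary_dist \<epsilon> x0 \<xi> \<eta> = 0"
      using lim LIMSEQ_unique asymptotic_tendsto gromov_boundary_asymptotic[OF \<eta> _ v] u by blast
  next
    assume "boundary_dist \<epsilon> x0 \<xi> \<eta> = 0"
    then have lim0: "(\<lambda>n. \<rho> (u n) (v n)) \<longlonglongrightarrow> 0"
      using lim by simp
    have us: "u \<in> sequences_to_infinity x0" and vs: "v \<in> sequences_to_infinity x0"
      using gromov_boundary_subset \<xi> \<eta> u v by blast+
    \<comment> \<open>The vanishing limit controls equal indices only. Independent indices are
      reached by inserting \<open>u j\<close> between \<open>u i\<close> and \<open>v j\<close>,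
      since \<open>u\<close> is Cauchy for the kernel.\<close>
    have "\<exists>N. \<forall>i\<ge>N. \<forall>j\<ge>N. \<rho> (u i) (v j) < e" if "0 < e" for e
    proof -
      have e2: "0 < e / 2" using that by simp
      obtain N1 where N1: "\<And>i j. i \<ge> N1 \<Longrightarrow> j \<ge> N1 \<Longrightarrow> \<rho> (u i) (u j) < e / 2"
        using us e2 unfolding sequences_to_infinity_iff by blast
      obtain N2 where N2: "\<And>j. j \<ge> N2 \<Longrightarrow> \<rho> (u j) (v j) < e / 2"
        using order_tendstoD(2)[OF lim0 e2] unfolding eventually_sequentially by blast
      have "\<rho> (u i) (v j) < e" if "i \<ge> max N1 N2" "j \<ge> max N1 N2" for i j
        using visual_kernel_triangle[of "u i" "v j" "u j"] N1[of i j] N2[of j] that by simp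
      then show ?thesis by blast
    qed
    then have "(u, v) \<in> asymptotic x0"
      by (simp add: asymptotic_iff us vs)
    then show "\<xi> = \<eta>"
      using quotient_eqI[OF equiv_asymptotic] \<xi> \<eta> u v unfolding gromov_boundary_def by blast
  qed
qed

lemma Metric_space_gromov_boundary:
  "Metric_space (gromov_boundary x0) (boundary_dist \<epsilon> x0)"
proof
  fix \<xi> \<eta> \<zeta> assume \<xi>: "\<xi> \<in> gromov_boundary x0" and \<eta>: "\<eta> \<in> gromov_boundary x0"
    and \<zeta>: "\<zeta> \<in> gromov_boundary x0"
  obtain u v w where "u \<in> \<xi>" "v \<in> \<eta>" "w \<in> \<zeta>"
    using gromov_boundary_nonempty[OF \<xi>] gromov_boundary_nonempty[OF \<eta>] gromov_boundary_nonempty[OF \<zeta>]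
    by blast
  note lim = boundary_dist_tendsto[OF \<xi> \<open>u \<in> \<xi>\<close> \<eta> \<open>v \<in> \<eta>\<close>]
    boundary_dist_tendsto[OF \<eta> \<open>v \<in> \<eta>\<close> \<zeta> \<open>w \<in> \<zeta>\<close>] boundary_dist_tendsto[OF \<xi> \<open>u \<in> \<xi>\<close> \<zeta> \<open>w \<in> \<zeta>\<close>]
  show "boundary_dist \<epsilon> x0 \<xi> \<zeta> \<le> boundary_dist \<epsilon> x0 \<xi> \<eta> + boundary_dist \<epsilon> x0 \<eta> \<zeta>"
    by (rule LIMSEQ_le[OF lim(3) tendsto_add[OF lim(1,2)]])
      (intro exI allI impI visual_kernel_triangle)
qed (rule boundary_dist_nonneg boundary_dist_commute boundary_dist_eq_0_iff; assumption)+

section \<open>Isometries acting on the boundary\<close>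

lemma visual_kernel_isometry:
  assumes "\<And>x y. dist (g x) (g y) = dist x y"
  shows "\<rho> (g x) (g y) \<le> exp (\<epsilon> * dist x0 (g x0)) * \<rho> x y"
proof -
  have "dist z x0 \<le> dist (g z) x0 + dist x0 (g x0)" for z
    using dist_triangle[of "g z" "g x0" x0] assms by simp
  \<comment> \<open>Each of the two distances to the base point drops by at most
    \<open>dist x0 (g x0)\<close>; the factor one half in the Gromov product turns the two losses
    into one.\<close>
  from this[of x] this[of y]
  have "gromov_product x0 x y - dist x0 (g x0) \<le> gromov_product x0 (g x) (g y)"
    using assms[of x y] by (simp add: gromov_product_def field_simps)
  then have "- \<epsilon> * gromov_product x0 (g x) (g y) \<le> \<epsilon> * dist x0 (g x0) + - \<epsilon> * gromov_product x0 x y"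
    using mult_left_mono[OF _ less_imp_le[OF \<epsilon>_pos]] by (fastforce simp: algebra_simps)
  then show ?thesis
    by (simp add: visual_kernel_def flip: exp_add)
qed

lemma isometry_asymptotic:
  assumes g: "\<And>x y. dist (g x) (g y) = dist x y" and uv: "(u, v) \<in> asymptotic x0"
  shows "(g \<circ> u, g \<circ> v) \<in> asymptotic x0"
proof -
  \<comment> \<open>Stated for arbitrary \<open>p\<close> and \<open>q\<close> because it is applied
    to the pairs \<open>u, u\<close>, then \<open>v, v\<close>, then \<open>u, v\<close>.\<close>
  have small: "\<forall>e>0. \<exists>N. \<forall>i\<ge>N. \<forall>j\<ge>N. \<rho> (g (p i)) (g (q j)) < e"
    if pq: "\<forall>e>0. \<exists>N. \<forall>i\<ge>N. \<forall>j\<ge>N. \<rho> (p i) (q j) < e" for p q :: "nat \<Rightarrow> 'a"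
  proof (intro allI impI)
    fix e :: real assume "0 < e"
    then have "0 < e / exp (\<epsilon> * dist x0 (g x0))" by simp
    then obtain N where N: "\<And>i j. i \<ge> N \<Longrightarrow> j \<ge> N \<Longrightarrow> \<rho> (p i) (q j) < e / exp (\<epsilon> * dist x0 (g x0))"
      using pq by blast
    have "\<rho> (g (p i)) (g (q j)) < e" if "i \<ge> N" "j \<ge> N" for i j
      using visual_kernel_isometry[OF g, of "p i" "q j"] N[OF that] by (simp add: field_simps)
    then show "\<exists>N. \<forall>i\<ge>N. \<forall>j\<ge>N. \<rho> (g (p i)) (g (q j)) < e" by blast
  qed
  show ?thesis
    using uv unfolding asymptotic_iff sequences_to_infinity_iff comp_def by (intro conjI small) blast+
qed

text \<open>The image of a class must be an entire class. A sequence \<open>w\<close> asymptotic to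
  \<open>g \<circ> u\<close> equals \<open>g \<circ> (h \<circ> w)\<close>, and
  \<open>h \<circ> w\<close> is asymptotic to \<open>u\<close>. The inverse is a separate variable
  \<open>h\<close>, so that the roles of the two maps can be exchanged.\<close>

lemma boundary_action_gromov_boundary:
  assumes g: "\<And>x y. dist (g x) (g y) = dist x y" and h: "\<And>x y. dist (h x) (h y) = dist x y"
    and gh: "\<And>x. g (h x) = x" and hg: "\<And>x. h (g x) = x" and \<xi>: "\<xi> \<in> gromov_boundary x0"
  shows "boundary_action g \<xi> \<in> gromov_boundary x0"
proof -
  obtain u where u: "u \<in> sequences_to_infinity x0" and \<xi>u: "\<xi> = asymptotic x0 `` {u}"
    using \<xi> unfolding gromov_boundary_def quotient_def by blast
  have "boundary_action g \<xi> = asymptotic x0 `` {g \<circ> u}"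
  proof
    show "boundary_action g \<xi> \<subseteq> asymptotic x0 `` {g \<circ> u}"
      using isometry_asymptotic[OF g] by (auto simp: \<xi>u boundary_action_def)
    show "asymptotic x0 `` {g \<circ> u} \<subseteq> boundary_action g \<xi>"
    proof
      fix w assume "w \<in> asymptotic x0 `` {g \<circ> u}"
      then have "(h \<circ> (g \<circ> u), h \<circ> w) \<in> asymptotic x0"
        using isometry_asymptotic[OF h] by blast
      moreover have "h \<circ> (g \<circ> u) = u" "w = g \<circ> (h \<circ> w)"
        by (auto simp: gh hg)
      ultimately show "w \<in> boundary_action g \<xi>"
        unfolding boundary_action_def \<xi>u by auto
    qed
  qed
  moreover have "g \<circ> u \<in> sequences_to_infinity x0"
    using isometry_asymptotic[OF g, of u u] u by (auto simp: asymptotic_iff sequences_to_infinity_iff)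
  ultimately show ?thesis
    by (simp add: gromov_boundary_def quotientI)
qed

lemma boundary_dist_boundary_action:
  assumes g: "\<And>x y. dist (g x) (g y) = dist x y" and h: "\<And>x y. dist (h x) (h y) = dist x y"
    and gh: "\<And>x. g (h x) = x" and hg: "\<And>x. h (g x) = x"
    and \<xi>: "\<xi> \<in> gromov_boundary x0" and \<eta>: "\<eta> \<in> gromov_boundary x0"
  shows "boundary_dist \<epsilon> x0 (boundary_action g \<xi>) (boundary_action g \<eta>)
    \<le> exp (\<epsilon> * dist x0 (g x0)) * boundary_dist \<epsilon> x0 \<xi> \<eta>"
proof -
  obtain u v where u: "u \<in> \<xi>" and v: "v \<in> \<eta>"
    using gromov_boundary_nonempty \<xi> \<eta> by blast
  have gu: "g \<circ> u \<in> boundary_action g \<xi>" and gv: "g \<circ> v \<in> boundary_action g \<eta>"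
    using u v by (auto simp: boundary_action_def)
  note mem = boundary_action_gromov_boundary[OF g h gh hg]
  show ?thesis
    by (rule LIMSEQ_le[OF boundary_dist_tendsto[OF mem[OF \<xi>] gu mem[OF \<eta>] gv]
          tendsto_mult_left[OF boundary_dist_tendsto[OF \<xi> u \<eta> v]]])
      (simp add: visual_kernel_isometry[OF g])
qed

end

section \<open>Hausdorff measures and Lipschitz maps\<close>

text \<open>The bound \<open>\<delta>\<close> makes the supremum a genuine one. Nonnegativity is
  what the monotonicity and multiplicativity of \<open>powr\<close> require of diameters.\<close>

lemma set_diameter_nonneg:
  assumes "\<And>x y. 0 \<le> d x y" "\<And>x y. \<lbrakk>x \<in> U; y \<in> U\<rbrakk> \<Longrightarrow> d x y \<le> \<delta>"
  shows "0 \<le> set_diameter d U"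
proof (cases "U = {}")
  case False
  then obtain x where "x \<in> U" by blast
  have "bdd_above ((\<lambda>(x, y). d x y) ` (U \<times> U))"
    using assms(2) by (auto simp: bdd_above_def)
  then have "d x x \<le> set_diameter d U"
    using cSUP_upper[of "(x, x)" "U \<times> U" "\<lambda>(x, y). d x y"] \<open>x \<in> U\<close> False
    by (simp add: set_diameter_def)
  then show ?thesis
    using assms(1)[of x x] by linarith
qed (simp add: set_diameter_def)

lemma set_diameter_lipschitz_image:
  assumes L: "0 \<le> L" "\<And>x y. \<lbrakk>x \<in> U; y \<in> U\<rbrakk> \<Longrightarrow> d (f x) (f y) \<le> L * d x y"
    and \<delta>: "\<And>x y. \<lbrakk>x \<in> U; y \<in> U\<rbrakk> \<Longrightarrow> d x y \<le> \<delta>"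
  shows "set_diameter d (f ` U) \<le> L * set_diameter d U"
proof (cases "U = {}")
  case False
  have bdd: "bdd_above ((\<lambda>(x, y). d x y) ` (U \<times> U))"
    using \<delta> by (auto simp: bdd_above_def)
  have "d (f x) (f y) \<le> L * set_diameter d U" if "x \<in> U" "y \<in> U" for x y
  proof -
    have "d x y \<le> set_diameter d U"
      using cSUP_upper[OF _ bdd, of "(x, y)"] that False by (simp add: set_diameter_def)
    then show ?thesis
      using L that by (meson mult_left_mono order_trans)
  qed
  then have "(SUP (x, y)\<in>f ` U \<times> f ` U. d x y) \<le> L * set_diameter d U"
    using False by (intro cSUP_least) auto
  then show ?thesis
    using False by (simp add: set_diameter_def)
qed (simp add: set_diameter_def)

text \<open>The images of a cover at scale \<open>\<delta>\<close> form a cover at scale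
  \<open>L * \<delta>\<close>, and each summand grows by at most the factor
  \<open>L powr t\<close>.\<close>

lemma hausdorff_premeasure_lipschitz_image:
  assumes d: "\<And>x y. 0 \<le> d x y" and t: "0 \<le> t" and L: "0 < L"
    and f: "f \<in> M \<rightarrow> M" and lip: "\<And>x y. \<lbrakk>x \<in> M; y \<in> M\<rbrakk> \<Longrightarrow> d (f x) (f y) \<le> L * d x y"
  shows "hausdorff_premeasure M d t (L * \<delta>) (f ` A)
    \<le> ennreal (L powr t) * hausdorff_premeasure M d t \<delta> A"
proof -
  let ?K = "ennreal (L powr t)"
  have cover: "hausdorff_premeasure M d t (L * \<delta>) (f ` A)
      \<le> ?K * (\<Sum>i. ennreal (set_diameter d (U i) powr t))"
    if U: "\<And>i. U i \<subseteq> M" "\<And>i x y. \<lbrakk>x \<in> U i; y \<in> U i\<rbrakk> \<Longrightarrow> d x y \<le> \<delta>" and A: "A \<subseteq> (\<Union>i. U i)"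
    for U :: "nat \<Rightarrow> 'a set"
  proof -
    have lipU: "d (f x) (f y) \<le> L * d x y" if "x \<in> U i" "y \<in> U i" for x y i
      using lip U(1) that by blast
    have \<delta>U: "d (f x) (f y) \<le> L * \<delta>" if "x \<in> U i" "y \<in> U i" for x y i
      using lipU[OF that] U(2)[OF that] L by (meson mult_left_mono less_imp_le order_trans)
    have "hausdorff_premeasure M d t (L * \<delta>) (f ` A)
        \<le> (\<Sum>i. ennreal (set_diameter d (f ` U i) powr t))"
      unfolding hausdorff_premeasure_def
      using f U(1) A \<delta>U by (intro INF_lower) (fastforce simp: Pi_iff)
    also have "\<dots> \<le> (\<Sum>i. ?K * ennreal (set_diameter d (U i) powr t))"
    proof (intro suminf_le summableI)
      fix i
      have diam: "0 \<le> set_diameter d (f ` U i)" "0 \<le> set_diameter d (U i)"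
        using \<delta>U U(2) by (auto intro!: set_diameter_nonneg d)
      have "set_diameter d (f ` U i) powr t \<le> (L * set_diameter d (U i)) powr t"
        using L lipU U(2) diam
        by (intro powr_mono2 t set_diameter_lipschitz_image[where \<delta> = \<delta>]) auto
      also have "\<dots> = L powr t * set_diameter d (U i) powr t"
        using L diam by (simp add: powr_mult)
      finally show "ennreal (set_diameter d (f ` U i) powr t)
          \<le> ?K * ennreal (set_diameter d (U i) powr t)"
        by (simp add: ennreal_leI flip: ennreal_mult)
    qed
    finally show ?thesis
      by simp
  qed
  \<comment> \<open>The factor is moved to the other side, so that the remaining right-hand side is
    a bare infimum, to be bounded cover by cover; afterwards it is moved back.\<close>
  have inv: "ennreal (1 / L powr t) * ?K = 1"
    using L by (simp flip: ennreal_mult)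
  have "ennreal (1 / L powr t) * hausdorff_premeasure M d t (L * \<delta>) (f ` A)
      \<le> hausdorff_premeasure M d t \<delta> A"
    unfolding hausdorff_premeasure_def[of M d t \<delta>]
  proof (rule INF_greatest)
    fix U :: "nat \<Rightarrow> 'a set" assume "U \<in> {U. (\<forall>i. U i \<subseteq> M \<and> (\<forall>x\<in>U i. \<forall>y\<in>U i. d x y \<le> \<delta>)) \<and> A \<subseteq> (\<Union>i. U i)}"
    then have "hausdorff_premeasure M d t (L * \<delta>) (f ` A)
        \<le> ?K * (\<Sum>i. ennreal (set_diameter d (U i) powr t))"
      by (intro cover) auto
    then have "ennreal (1 / L powr t) * hausdorff_premeasure M d t (L * \<delta>) (f ` A)
        \<le> (ennreal (1 / L powr t) * ?K) * (\<Sum>i. ennreal (set_diameter d (U i) powr t))"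
      unfolding mult.assoc by (rule mult_left_mono) simp
    then show "ennreal (1 / L powr t) * hausdorff_premeasure M d t (L * \<delta>) (f ` A)
        \<le> (\<Sum>i. ennreal (set_diameter d (U i) powr t))"
      by (simp add: inv)
  qed
  then have "(?K * ennreal (1 / L powr t)) * hausdorff_premeasure M d t (L * \<delta>) (f ` A)
      \<le> ?K * hausdorff_premeasure M d t \<delta> A"
    unfolding mult.assoc by (rule mult_left_mono) simp
  then show ?thesis
    using inv by (simp add: mult.commute)
qed

lemma hausdorff_outer_measure_lipschitz_image:
  assumes "\<And>x y. 0 \<le> d x y" "0 \<le> t" and L: "0 < L"
    and "f \<in> M \<rightarrow> M" "\<And>x y. \<lbrakk>x \<in> M; y \<in> M\<rbrakk> \<Longrightarrow> d (f x) (f y) \<le> L * d x y"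
  shows "hausdorff_outer_measure M d t (f ` A) \<le> ennreal (L powr t) * hausdorff_outer_measure M d t A"
  unfolding hausdorff_outer_measure_def
proof (rule SUP_least)
  fix \<delta> :: real assume "\<delta> \<in> {0<..}"
  \<comment> \<open>Covers of the image at scale \<open>\<delta>\<close> come from covers of
    \<open>A\<close> at scale \<open>\<delta> / L\<close>; the supremum over all scales absorbs the
    change.\<close>
  then have \<delta>: "\<delta> / L \<in> {0<..}" "L * (\<delta> / L) = \<delta>"
    using L by auto
  have "hausdorff_premeasure M d t \<delta> (f ` A) \<le> ennreal (L powr t) * hausdorff_premeasure M d t (\<delta> / L) A"
    using hausdorff_premeasure_lipschitz_image[of d t L f M "\<delta> / L" A] assms \<delta>(2) by simp
  also have "\<dots> \<le> ennreal (L powr t) * (SUP \<delta>\<in>{0<..}. hausdorff_premeasure M d t \<delta> A)"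
    by (intro mult_left_mono SUP_upper \<delta>(1)) simp
  finally show "hausdorff_premeasure M d t \<delta> (f ` A)
      \<le> ennreal (L powr t) * (SUP \<delta>\<in>{0<..}. hausdorff_premeasure M d t \<delta> A)" .
qed

lemma space_hausdorff_measure [simp]: "space (hausdorff_measure M d t) = M"
  by (simp add: hausdorff_measure_def space_measure_of_conv)

section \<open>Lipschitz maps and the Borel measure\<close>

context Metric_space
begin

lemma openin_mtopology_Pow: "{U. openin mtopology U} \<subseteq> Pow M"
  using openin_subset by fastforce

lemma sets_hausdorff_measure: "sets (hausdorff_measure M d t) = sigma_sets M {U. openin mtopology U}"
  using openin_mtopology_Pow by (simp add: hausdorff_measure_def)

lemma lipschitz_measurable_hausdorff_measure:
  assumes L: "0 < L" and f: "f \<in> M \<rightarrow> M"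
    and lip: "\<And>x y. \<lbrakk>x \<in> M; y \<in> M\<rbrakk> \<Longrightarrow> d (f x) (f y) \<le> L * d x y"
  shows "f \<in> hausdorff_measure M d t \<rightarrow>\<^sub>M hausdorff_measure M d t"
proof (rule measurable_sigma_sets[OF sets_hausdorff_measure openin_mtopology_Pow])
  fix U assume "U \<in> {U. openin mtopology U}"
  then have U: "openin mtopology U" by simp
  have "openin mtopology (f -` U \<inter> M)"
    unfolding openin_mtopology
  proof (intro conjI allI impI)
    fix x assume x: "x \<in> f -` U \<inter> M"
    then obtain r where r: "r > 0" "mball (f x) r \<subseteq> U"
      using U unfolding openin_mtopology by blast
    have "mball x (r / L) \<subseteq> f -` U \<inter> M"
    proof
      fix y assume "y \<in> mball x (r / L)"
      then have y: "y \<in> M" "L * d x y < r"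
        using L by (auto simp: field_simps)
      then have "d (f x) (f y) < r"
        using lip[of x y] x by simp
      then show "y \<in> f -` U \<inter> M"
        using r(2) x y(1) funcset_mem[OF f] by (auto simp: subset_iff)
    qed
    then show "\<exists>r>0. mball x r \<subseteq> f -` U \<inter> M"
      using r(1) L by (meson divide_pos_pos)
  qed auto
  then show "f -` U \<inter> space (hausdorff_measure M d t) \<in> sets (hausdorff_measure M d t)"
    by (simp add: sets_hausdorff_measure sigma_sets.Basic)
qed (use f in simp)

text \<open>\<open>measure_of\<close> returns the outer measure on measurable sets if it is
  countably additive there, and 0 otherwise. Where the default 0 occurs, the left-hand side is 0 and
  the bound is trivial; elsewhere it is the bound for outer measures.\<close>

lemma emeasure_hausdorff_measure_lipschitz_image:
  assumes L: "0 < L" and f: "f \<in> M \<rightarrow> M"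
    and lip: "\<And>x y. \<lbrakk>x \<in> M; y \<in> M\<rbrakk> \<Longrightarrow> d (f x) (f y) \<le> L * d x y" and t: "0 \<le> t"
    and A: "A \<in> sets (hausdorff_measure M d t)"
  shows "emeasure (hausdorff_measure M d t) (f ` A)
    \<le> ennreal (L powr t) * emeasure (hausdorff_measure M d t) A"
  using hausdorff_outer_measure_lipschitz_image[of d, OF nonneg t L f lip, of A] A
  by (auto simp: hausdorff_measure_def emeasure_measure_of_conv openin_mtopology_Pow)

end

section \<open>Weighted composition operators\<close>

text \<open>Tested on the set where \<open>g < f\<close>, the inequality forces the integral of
  \<open>f - g\<close> over that set to be 0, so the set is null. Finiteness of the integral of
  \<open>g\<close> makes the subtraction of extended integrals legitimate.\<close>

lemma AE_le_of_set_nn_integral_le: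
  fixes f g :: "'a \<Rightarrow> ennreal"
  assumes [measurable]: "f \<in> borel_measurable M" "g \<in> borel_measurable M"
    and fin: "(\<integral>\<^sup>+x. g x \<partial>M) \<noteq> \<infinity>"
    and le: "\<And>A. A \<in> sets M \<Longrightarrow> (\<integral>\<^sup>+x. f x * indicator A x \<partial>M) \<le> (\<integral>\<^sup>+x. g x * indicator A x \<partial>M)"
  shows "AE x in M. f x \<le> g x"
proof -
  define A where "A = {x \<in> space M. g x < f x}"
  have [measurable]: "A \<in> sets M"
    by (simp add: A_def)
  have "(\<integral>\<^sup>+x. g x * indicator A x \<partial>M) \<le> (\<integral>\<^sup>+x. g x \<partial>M)"
    by (intro nn_integral_mono) (simp add: indicator_def)
  then have "(\<integral>\<^sup>+x. g x * indicator A x \<partial>M) \<noteq> \<infinity>"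
    using fin by (metis infinity_ennreal_def neq_top_trans)
  then have "(\<integral>\<^sup>+x. f x * indicator A x - g x * indicator A x \<partial>M)
      = (\<integral>\<^sup>+x. f x * indicator A x \<partial>M) - (\<integral>\<^sup>+x. g x * indicator A x \<partial>M)"
    by (intro nn_integral_diff) (auto simp: A_def indicator_def)
  also have "\<dots> = 0"
    using le[of A] \<open>(\<integral>\<^sup>+x. g x * indicator A x \<partial>M) \<noteq> \<infinity>\<close>
    by (simp add: diff_eq_0_iff_ennreal le_less_trans top.not_eq_extremum)
  finally have "AE x in M. f x * indicator A x - g x * indicator A x = 0"
    by (subst (asm) nn_integral_0_iff_AE) auto
  with AE_space show ?thesis
  proof eventually_elim
    case (elim x)
    then show ?case
      by (cases "x \<in> A") (auto simp: A_def diff_eq_0_iff_ennreal)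
  qed
qed

text \<open>The upper bound gives absolute continuity, so integrating the derivative over
  \<open>A\<close> gives \<open>emeasure N A\<close>. Both set inequalities then compare integrals
  of the derivative with those of a constant over every measurable set, hence pointwise almost
  everywhere.\<close>

lemma (in finite_measure) RN_deriv_bounds:
  assumes N: "sets N = sets M" and a: "0 < a"
    and upper: "\<And>A. A \<in> sets M \<Longrightarrow> emeasure N A \<le> ennreal a * emeasure M A"
    and lower: "\<And>A. A \<in> sets M \<Longrightarrow> emeasure M A \<le> ennreal a * emeasure N A"
  shows "AE x in M. ennreal (1 / a) \<le> RN_deriv M N x \<and> RN_deriv M N x \<le> ennreal a"
    and "density M (RN_deriv M N) = N"
proof -
  have "absolutely_continuous M N"
    unfolding absolutely_continuous_def null_sets_def using N upper by fastforce
  then show dens: "density M (RN_deriv M N) = N"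
    using N by (rule density_RN_deriv)
  have D: "(\<integral>\<^sup>+x. RN_deriv M N x * indicator A x \<partial>M) = emeasure N A" if "A \<in> sets M" for A
    using that by (simp flip: emeasure_density add: dens)
  have "emeasure N (space M) < \<infinity>"
    using upper[of "space M"] emeasure_finite[of "space M"]
    by (metis ennreal_mult_less_top ennreal_less_top infinity_ennreal_def le_less_trans sets.top
        top.not_eq_extremum)
  moreover have "(\<integral>\<^sup>+x. RN_deriv M N x \<partial>M) = (\<integral>\<^sup>+x. RN_deriv M N x * indicator (space M) x \<partial>M)"
    by (intro nn_integral_cong) simp
  ultimately have finD: "(\<integral>\<^sup>+x. RN_deriv M N x \<partial>M) \<noteq> \<infinity>"
    using D[of "space M"] by simp
  have "AE x in M. RN_deriv M N x \<le> ennreal a"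
  proof (rule AE_le_of_set_nn_integral_le)
    show "(\<integral>\<^sup>+x. ennreal a \<partial>M) \<noteq> \<infinity>"
      by (simp add: ennreal_mult_eq_top_iff)
  qed (simp_all add: D upper nn_integral_cmult_indicator)
  moreover have "AE x in M. ennreal (1 / a) \<le> RN_deriv M N x"
  proof (rule AE_le_of_set_nn_integral_le[OF _ _ finD])
    fix A assume A: "A \<in> sets M"
    have "ennreal (1 / a) * emeasure M A \<le> ennreal (1 / a) * (ennreal a * emeasure N A)"
      by (intro mult_left_mono lower A) simp
    also have "\<dots> = emeasure N A"
      using a by (simp flip: mult.assoc ennreal_mult)
    finally show "(\<integral>\<^sup>+x. ennreal (1 / a) * indicator A x \<partial>M) \<le> (\<integral>\<^sup>+x. RN_deriv M N x * indicator A x \<partial>M)"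
      using A by (simp add: D nn_integral_cmult_indicator)
  qed simp_all
  ultimately show "AE x in M. ennreal (1 / a) \<le> RN_deriv M N x \<and> RN_deriv M N x \<le> ennreal a"
    by eventually_elim simp
qed

text \<open>The hypotheses say \<open>\<bar>ln r\<bar> \<le> ln a\<close>, which treats positive and
  negative exponents alike.\<close>

lemma powr_le_powr_abs:
  fixes a r p :: real
  assumes "0 < a" "1 / a \<le> r" "r \<le> a"
  shows "r powr p \<le> a powr \<bar>p\<bar>"
proof -
  have r: "0 < r"
    using assms by (meson divide_pos_pos less_le_trans zero_less_one)
  then have "ln r \<le> ln a" "- ln r \<le> ln a"
    using assms ln_mono[of "1 / a" r] by (simp_all add: ln_div)
  then have "\<bar>p\<bar> * \<bar>ln r\<bar> \<le> \<bar>p\<bar> * ln a"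
    by (intro mult_left_mono) auto
  then have "p * ln r \<le> \<bar>p\<bar> * ln a"
    by (metis abs_ge_self abs_mult order_trans)
  then show ?thesis
    using r assms(1) by (simp add: powr_def)
qed

text \<open>Abstract form of the operator bound: \<open>g\<close> stands for the boundary action of
  a group element and \<open>h\<close> for that of its inverse.\<close>

lemma (in finite_measure) L2_norm_weighted_composition:
  fixes v :: "'a \<Rightarrow> complex"
  assumes g [measurable]: "g \<in> M \<rightarrow>\<^sub>M M" and h [measurable]: "h \<in> M \<rightarrow>\<^sub>M M"
    and hg: "\<And>x. x \<in> space M \<Longrightarrow> h (g x) = x" and a: "0 < a"
    and upper: "\<And>A. A \<in> sets M \<Longrightarrow> emeasure M (g -` A \<inter> space M) \<le> ennreal a * emeasure M A"
    and lower: "\<And>A. A \<in> sets M \<Longrightarrow> emeasure M A \<le> ennreal a * emeasure M (g -` A \<inter> space M)"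
    and v: "L2_norm M v \<le> 1"
  shows "L2_norm M (\<lambda>x. of_real (enn2real (RN_deriv M (distr M M g) x) powr s) * v (h x))
    \<le> ennreal (a powr \<bar>1/2 - s\<bar>)"
proof -
  let ?N = "distr M M g" and ?D = "RN_deriv M (distr M M g)" and ?K = "a powr \<bar>2 * s - 1\<bar>"
  let ?w = "\<lambda>x. of_real (enn2real (?D x) powr s) * v (h x)"
  \<comment> \<open>A norm of at most 1 excludes the default value \<open>\<infinity>\<close>, so
    \<open>v\<close> is measurable and square integrable.\<close>
  have vm [measurable]: "v \<in> borel_measurable M" and vi: "integrable M (\<lambda>x. (cmod (v x))\<^sup>2)"
    and v1: "ennreal (sqrt (LINT x|M. (cmod (v x))\<^sup>2)) \<le> 1"
    using v by (auto simp: L2_norm_def top_unique split: if_splits)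
  have v2: "(\<integral>\<^sup>+x. ennreal ((cmod (v x))\<^sup>2) \<partial>M) \<le> 1"
    using v1 by (subst nn_integral_eq_integral[OF vi]) simp_all
  have upper': "emeasure ?N A \<le> ennreal a * emeasure M A" if "A \<in> sets M" for A
    using upper[OF that] that by (simp add: emeasure_distr)
  have lower': "emeasure M A \<le> ennreal a * emeasure ?N A" if "A \<in> sets M" for A
    using lower[OF that] that by (simp add: emeasure_distr)
  have RN: "AE x in M. ennreal (1 / a) \<le> ?D x \<and> ?D x \<le> ennreal a" "density M ?D = ?N"
    by (rule RN_deriv_bounds[OF sets_distr a]; erule upper' lower')+
  have bound: "AE x in M. ennreal ((cmod (?w x))\<^sup>2) \<le> ennreal ?K * (?D x * ennreal ((cmod (v (h x)))\<^sup>2))"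
    using RN(1)
  proof eventually_elim
    case (elim x)
    define r where "r = enn2real (?D x)"
    have "?D x < \<infinity>"
      using elim by (auto simp: top.not_eq_extremum intro: le_less_trans)
    then have Dr: "?D x = ennreal r"
      by (simp add: r_def)
    have r0: "0 \<le> r" by (simp add: r_def)
    have r: "1 / a \<le> r" "r \<le> a"
      using elim a r0 by (simp_all add: Dr)
    then have "0 < r"
      using a by (meson divide_pos_pos less_le_trans zero_less_one)
    \<comment> \<open>One factor \<open>r\<close> is kept as the density for the change of
      variables; splitting it off uses \<open>r > 0\<close>, which the lower bound on the derivative
      supplies.\<close>
    have "(r powr s)\<^sup>2 = r powr (2 * s - 1) * r"
      using \<open>0 < r\<close> by (simp add: powr_diff powr_power mult.commute)
    also have "\<dots> \<le> ?K * r"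
      using powr_le_powr_abs[OF a r] r0 by (intro mult_right_mono) auto
    finally have "(cmod (?w x))\<^sup>2 \<le> ?K * (r * (cmod (v (h x)))\<^sup>2)"
      by (simp add: norm_mult power_mult_distrib mult_right_mono flip: r_def mult.assoc)
    then show ?case
      using r0 by (simp add: Dr ennreal_leI flip: ennreal_mult)
  qed
  have "(\<integral>\<^sup>+x. ennreal ((cmod (?w x))\<^sup>2) \<partial>M)
      \<le> (\<integral>\<^sup>+x. ennreal ?K * (?D x * ennreal ((cmod (v (h x)))\<^sup>2)) \<partial>M)"
    by (rule nn_integral_mono_AE[OF bound])
  also have "\<dots> = ennreal ?K * (\<integral>\<^sup>+x. ennreal ((cmod (v (h x)))\<^sup>2) \<partial>density M ?D)"
    by (simp add: nn_integral_cmult nn_integral_density)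
  \<comment> \<open>The measure with density \<open>?D\<close> is the push-forward under
    \<open>g\<close>, and \<open>h\<close> undoes \<open>g\<close>.\<close>
  also have "\<dots> = ennreal ?K * (\<integral>\<^sup>+x. ennreal ((cmod (v (h (g x))))\<^sup>2) \<partial>M)"
    by (simp add: RN(2) nn_integral_distr)
  also have "\<dots> = ennreal ?K * (\<integral>\<^sup>+x. ennreal ((cmod (v x))\<^sup>2) \<partial>M)"
    by (simp add: hg cong: nn_integral_cong)
  also have "\<dots> \<le> ennreal ?K * 1"
    by (intro mult_left_mono v2) simp
  finally have le: "(\<integral>\<^sup>+x. ennreal ((cmod (?w x))\<^sup>2) \<partial>M) \<le> ennreal ?K"
    by simp
  \<comment> \<open>Integrability ensures that the norm of the image is given by the integral and
    not by the default \<open>\<infinity>\<close>.\<close>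
  have wi: "integrable M (\<lambda>x. (cmod (?w x))\<^sup>2)"
    using le by (intro integrableI_bounded) (simp_all add: le_less_trans)
  have "(LINT x|M. (cmod (?w x))\<^sup>2) \<le> ?K"
    using le by (subst (asm) nn_integral_eq_integral[OF wi]) simp_all
  then have "sqrt (LINT x|M. (cmod (?w x))\<^sup>2) \<le> sqrt ?K"
    by simp
  also have "sqrt ?K = ?K powr (1 / 2)"
    by (rule powr_half_sqrt[symmetric]) simp
  also have "\<dots> = a powr \<bar>1/2 - s\<bar>"
  proof -
    have "\<bar>2 * s - 1\<bar> * (1 / 2) = \<bar>1/2 - s\<bar>"
      by (simp add: abs_if field_simps)
    then show ?thesis by (simp only: powr_powr)
  qed
  finally show ?thesis
    using wi by (simp add: L2_norm_def ennreal_leI)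
qed

section \<open>Boundary representations\<close>

text \<open>For total mass 0 or \<open>\<infinity>\<close> the scaling factor is
  \<open>\<infinity>\<close> or 0 respectively, and its product with the mass is 0 in both
  cases.\<close>

lemma emeasure_scale_measure_normalized_le_1:
  "emeasure (scale_measure (1 / emeasure M (space M)) M) (space M) \<le> 1"
proof (cases "emeasure M (space M) = 0 \<or> emeasure M (space M) = \<infinity>")
  case False
  then show ?thesis
    by (simp add: ennreal_divide_times top.not_eq_extremum)
qed auto

text \<open>The logarithm of a cardinality is nonnegative, with \<open>ln 0 = 0\<close> covering
  cardinality 0. This makes the Hausdorff dimension nonnegative, as the Lipschitz estimates
  require.\<close>

lemma volume_growth_nonneg: "0 \<le> volume_growth \<Gamma> x0"
proof -
  have "0 \<le> Limsup at_top (\<lambda>T::real. ereal (ln (real (card ((\<lambda>\<gamma>. \<gamma> x0) ` \<Gamma> \<inter> ball x0 T))) / T))"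
  proof (rule le_Limsup)
    show "\<forall>\<^sub>F T::real in at_top. 0 \<le> ereal (ln (real (card ((\<lambda>\<gamma>. \<gamma> x0) ` \<Gamma> \<inter> ball x0 T))) / T)"
      using eventually_ge_at_top[of 0]
    proof eventually_elim
      case (elim T)
      have "0 \<le> ln (real n)" for n
        by (cases "n = 0") auto
      with elim show ?case by simp
    qed
  qed simp
  then show ?thesis
    by (simp add: volume_growth_def real_of_ereal_pos)
qed

lemma space_patterson_sullivan [simp]: "space (patterson_sullivan \<epsilon> \<Gamma> x0) = gromov_boundary x0"
  by (simp add: patterson_sullivan_def Let_def space_scale_measure)

lemma finite_measure_patterson_sullivan: "finite_measure (patterson_sullivan \<epsilon> \<Gamma> x0)"
proof
  have "emeasure (patterson_sullivan \<epsilon> \<Gamma> x0) (gromov_boundary x0) \<le> 1"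
    using emeasure_scale_measure_normalized_le_1
      [of "hausdorff_measure (gromov_boundary x0) (boundary_dist \<epsilon> x0) (volume_growth \<Gamma> x0 / \<epsilon>)"]
    by (simp add: patterson_sullivan_def Let_def)
  then show "emeasure (patterson_sullivan \<epsilon> \<Gamma> x0) (space (patterson_sullivan \<epsilon> \<Gamma> x0)) \<noteq> \<infinity>"
    by (auto simp: top_unique)
qed

lemma boundary_action_inverse:
  assumes "\<And>x. h (g x) = x"
  shows "boundary_action h (boundary_action g \<xi>) = \<xi>"
  by (simp add: boundary_action_def image_image comp_def assms)

lemma isometry_group_mem:
  assumes "isometry_group \<Gamma>" "\<gamma> \<in> \<Gamma>"
  shows "bij \<gamma>" "dist (\<gamma> x) (\<gamma> y) = dist x y"
  using assms by (auto simp: isometry_group_def subgroup_def BijGroup_def Bij_def)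

section \<open>Distortion of the Patterson-Sullivan measure and the operator bound\<close>

context strongly_hyperbolic_space
begin

context
  fixes g h :: "'a \<Rightarrow> 'a" and \<Gamma> :: "('a \<Rightarrow> 'a) set"
  assumes g: "\<And>x y. dist (g x) (g y) = dist x y" and h: "\<And>x y. dist (h x) (h y) = dist x y"
    and gh: "\<And>x. g (h x) = x" and hg: "\<And>x. h (g x) = x"
begin

lemma boundary_action_measurable:
  "boundary_action g \<in> patterson_sullivan \<epsilon> \<Gamma> x0 \<rightarrow>\<^sub>M patterson_sullivan \<epsilon> \<Gamma> x0"
proof -
  have "boundary_action g \<in> hausdorff_measure (gromov_boundary x0) (boundary_dist \<epsilon> x0) t
      \<rightarrow>\<^sub>M hausdorff_measure (gromov_boundary x0) (boundary_dist \<epsilon> x0) t" for t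
    by (rule Metric_space.lipschitz_measurable_hausdorff_measure[OF Metric_space_gromov_boundary,
          where L = "exp (\<epsilon> * dist x0 (g x0))"])
      (auto intro: boundary_action_gromov_boundary boundary_dist_boundary_action g h gh hg)
  then show ?thesis
    by (simp add: patterson_sullivan_def Let_def cong: measurable_cong_sets)
qed

lemma emeasure_patterson_sullivan_boundary_action:
  assumes "A \<in> sets (patterson_sullivan \<epsilon> \<Gamma> x0)"
  shows "emeasure (patterson_sullivan \<epsilon> \<Gamma> x0) (boundary_action g ` A)
    \<le> ennreal (exp (volume_growth \<Gamma> x0 * dist x0 (g x0))) * emeasure (patterson_sullivan \<epsilon> \<Gamma> x0) A"
proof -
  let ?t = "volume_growth \<Gamma> x0 / \<epsilon>"
  let ?H = "hausdorff_measure (gromov_boundary x0) (boundary_dist \<epsilon> x0) ?t"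
  have t: "0 \<le> ?t"
    by (simp add: volume_growth_nonneg \<epsilon>_pos less_imp_le)
  have A: "A \<in> sets ?H"
    using assms by (simp add: patterson_sullivan_def Let_def)
  have "emeasure ?H (boundary_action g ` A) \<le> ennreal (exp (\<epsilon> * dist x0 (g x0)) powr ?t) * emeasure ?H A"
    by (rule Metric_space.emeasure_hausdorff_measure_lipschitz_image[OF Metric_space_gromov_boundary _ _ _ t A])
      (auto intro: boundary_action_gromov_boundary boundary_dist_boundary_action g h gh hg)
  \<comment> \<open>The dimension is the volume growth divided by \<open>\<epsilon>\<close>, so
    \<open>\<epsilon>\<close> cancels.\<close>
  also have "exp (\<epsilon> * dist x0 (g x0)) powr ?t = exp (volume_growth \<Gamma> x0 * dist x0 (g x0))"
    using \<epsilon>_pos by (simp add: powr_def)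
  finally have "emeasure ?H (boundary_action g ` A)
      \<le> ennreal (exp (volume_growth \<Gamma> x0 * dist x0 (g x0))) * emeasure ?H A" .
  \<comment> \<open>Both sides are scaled by the same normalizing factor, whether it is finite or
    infinite.\<close>
  from mult_left_mono[OF this, of "1 / emeasure ?H (space ?H)"] show ?thesis
    by (simp add: patterson_sullivan_def Let_def mult.left_commute)
qed

end

lemma L2_norm_boundary_representation:
  assumes \<Gamma>: "isometry_group \<Gamma>" and \<gamma>: "\<gamma> \<in> \<Gamma>" and v: "L2_norm (patterson_sullivan \<epsilon> \<Gamma> x0) v \<le> 1"
  shows "L2_norm (patterson_sullivan \<epsilon> \<Gamma> x0) (boundary_representation (patterson_sullivan \<epsilon> \<Gamma> x0) s \<gamma> v)
    \<le> ennreal (exp (volume_growth \<Gamma> x0 * \<bar>1/2 - s\<bar> * dist x0 (\<gamma> x0)))"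
proof -
  let ?\<nu> = "patterson_sullivan \<epsilon> \<Gamma> x0"
  let ?g = "boundary_action \<gamma>" and ?k = "inv_into UNIV \<gamma>"
  let ?h = "boundary_action ?k" and ?a = "exp (volume_growth \<Gamma> x0 * dist x0 (\<gamma> x0))"
  note bij = isometry_group_mem(1)[OF \<Gamma> \<gamma>] and isom = isometry_group_mem(2)[OF \<Gamma> \<gamma>]
  have gh: "\<gamma> (?k x) = x" and hg: "?k (\<gamma> x) = x" for x
    using bij by (auto simp: bij_def surj_f_inv_f)
  have gh': "?g (?h \<xi>) = \<xi>" and hg': "?h (?g \<xi>) = \<xi>" for \<xi>
    by (rule boundary_action_inverse, rule gh) (rule boundary_action_inverse, rule hg)
  have isom': "dist (?k x) (?k y) = dist x y" for x y
    using isom[of "?k x" "?k y"] by (simp add: gh)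
  \<comment> \<open>Thanks to this equality one constant \<open>?a\<close> serves for the element
    and for its inverse.\<close>
  have dist_inv: "dist x0 (?k x0) = dist x0 (\<gamma> x0)"
    using isom[of x0 "?k x0"] by (simp add: gh dist_commute)
  note meas = boundary_action_measurable[OF isom isom' gh hg, of \<Gamma>]
    and meas' = boundary_action_measurable[OF isom' isom hg gh, of \<Gamma>]
  note distort = emeasure_patterson_sullivan_boundary_action[OF isom isom' gh hg, of _ \<Gamma>]
    and distort' = emeasure_patterson_sullivan_boundary_action[OF isom' isom hg gh, of _ \<Gamma>, unfolded dist_inv]
  \<comment> \<open>Turns the distortion estimates, which concern images, into estimates for the
    preimages that define the push-forward.\<close>
  have vimage: "?g -` A \<inter> space ?\<nu> = ?h ` A" if "A \<in> sets ?\<nu>" for A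
  proof
    show "?g -` A \<inter> space ?\<nu> \<subseteq> ?h ` A"
      by (auto simp: hg' intro!: image_eqI[where x = "?g _"])
    show "?h ` A \<subseteq> ?g -` A \<inter> space ?\<nu>"
      using sets.sets_into_space[OF that] measurable_space[OF meas']
      by (auto simp: gh')
  qed
  have "L2_norm ?\<nu> (\<lambda>\<xi>. of_real (enn2real (RN_deriv ?\<nu> (distr ?\<nu> ?\<nu> ?g) \<xi>) powr s) * v (?h \<xi>))
      \<le> ennreal (?a powr \<bar>1/2 - s\<bar>)"
  proof (rule finite_measure.L2_norm_weighted_composition[OF finite_measure_patterson_sullivan meas meas' _ _ _ _ v])
    fix A assume A: "A \<in> sets ?\<nu>"
    show "emeasure ?\<nu> (?g -` A \<inter> space ?\<nu>) \<le> ennreal ?a * emeasure ?\<nu> A"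
      unfolding vimage[OF A] by (rule distort'[OF A])
    \<comment> \<open>The lower bound comes from writing \<open>A\<close> as the image under
      \<open>?g\<close> of \<open>?h\<close> followed by \<open>A\<close>, a measurable set to which
      the distortion estimate for \<open>\<gamma>\<close> applies.\<close>
    have "?h ` A \<in> sets ?\<nu>"
      using measurable_sets[OF meas A] by (simp only: vimage[OF A])
    from distort[OF this] show "emeasure ?\<nu> A \<le> ennreal ?a * emeasure ?\<nu> (?g -` A \<inter> space ?\<nu>)"
      by (simp add: vimage[OF A, simplified] image_image gh')
  qed (simp_all add: hg')
  also have "?a powr \<bar>1/2 - s\<bar> = exp (volume_growth \<Gamma> x0 * \<bar>1/2 - s\<bar> * dist x0 (\<gamma> x0))"
    by (simp add: powr_def mult_ac)
  finally show ?thesis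
    by (simp add: boundary_representation_def[abs_def])
qed

end

theorem corollary1p5:
  fixes x0 :: "'a::metric_space" and \<Gamma> :: "('a \<Rightarrow> 'a) set" and \<epsilon> s :: real
  assumes "proper_space TYPE('a)"
    and "roughly_geodesic TYPE('a)"
    and "strongly_hyperbolic \<epsilon> TYPE('a)"
    and "isometry_group \<Gamma>"
    and "properly_discontinuous \<Gamma>"
    and "non_elementary \<Gamma> x0"
    and "cocompact \<Gamma>"
    and "s \<in> {0..<1/2} \<union> {1/2<..1}"
  shows "\<exists>C>0. \<forall>\<gamma>\<in>\<Gamma>.
           L2_operator_norm (patterson_sullivan \<epsilon> \<Gamma> x0)
             (boundary_representation (patterson_sullivan \<epsilon> \<Gamma> x0) s \<gamma>)
           \<le> ennreal (C * exp (volume_growth \<Gamma> x0 * \<bar>1/2 - s\<bar> * dist x0 (\<gamma> x0)))"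
proof -
  interpret strongly_hyperbolic_space \<epsilon> x0
    using assms by unfold_locales
  show ?thesis
    \<comment> \<open>The operator norm is a supremum over the unit ball, so the bound for each
      single \<open>v\<close> suffices.\<close>
    using assms(4) by (intro exI[of _ 1])
      (auto simp: L2_operator_norm_def intro!: SUP_least L2_norm_boundary_representation)
qed

end
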